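(* Let $X,X_1,X_2,\dots$ be i.i.d. non-negative random variables and let $N(t)$, $t>0$, be a homogeneous Poisson process with rate $\lambda>0$, independent of the $X_j$. Put $N_\pi(t)=\prod_{j=1}^{N(t)}X_j$. Then for every $t>0$ and every $\eta$ for which $X^{\eta-1}$ is almost surely well defined and integrable, $$\mathbb{E}\left[N_\pi(t)\right]^{\eta-1}=e^{\lambda t\left(\mathbb{E}X^{\eta-1}-1\right)}.$$
   Context: An empty product equals $1$. The parameter $\eta$ may be complex, $x^{\eta-1}=e^{(\eta-1)\log x}$ for $x>0$; $0^s=0$ if $\mathrm{Re}\,s>0$, $0^0=1$, and $0^s$ is otherwise undefined. *)

theory Defs
  imports "HOL-Probability.Probability"
begin

text \<open>
  Complex powers of a non-negative real base. HOL's \<open>powr\<close> is not used because \<open>0 powr s = 0\<close>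
  for every \<open>s\<close>; here \<open>0\<^sup>0 = 1\<close>, and \<open>0\<^sup>s\<close> has no meaningful value unless \<open>Re s > 0\<close> or \<open>s = 0\<close>.
\<close>

definition cpow_defined :: "real \<Rightarrow> complex \<Rightarrow> bool" where
  "cpow_defined x s \<longleftrightarrow> x > 0 \<or> x = 0 \<and> (Re s > 0 \<or> s = 0)"

definition cpow :: "real \<Rightarrow> complex \<Rightarrow> complex" where
  "cpow x s =
     (if x > 0 then exp (s * of_real (ln x))
      else if x = 0 \<and> Re s > 0 then 0
      else if x = 0 \<and> s = 0 then 1
      else undefined)"

context prob_space
begin

text \<open>
  Since paths are almost surely nondecreasing, the truncated subtraction on \<open>nat\<close> in the
  increments is the true difference outside a null set.
\<close>

definition poisson_process :: "real \<Rightarrow> (real \<Rightarrow> 'a \<Rightarrow> nat) \<Rightarrow> bool" where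
  "poisson_process lam N \<longleftrightarrow>
     (\<forall>t\<ge>0. random_variable (count_space UNIV) (N t)) \<and>
     (AE \<omega> in M. N 0 \<omega> = 0) \<and>
     (AE \<omega> in M. mono_on {0..} (\<lambda>t. N t \<omega>) \<and>
                 (\<forall>t\<ge>0. continuous (at_right t) (\<lambda>u. N u \<omega>))) \<and>
     (\<forall>(n::nat) (s :: nat \<Rightarrow> real). 0 \<le> s 0 \<longrightarrow> (\<forall>i<n. s i \<le> s (Suc i)) \<longrightarrow>
        indep_vars (\<lambda>_. count_space UNIV) (\<lambda>i \<omega>. N (s (Suc i)) \<omega> - N (s i) \<omega>) {..<n}) \<and>
     (\<forall>s t. 0 \<le> s \<longrightarrow> s < t \<longrightarrow>
        distr M (count_space UNIV) (\<lambda>\<omega>. N t \<omega> - N s \<omega>) =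
          measure_pmf (poisson_pmf (lam * (t - s))))"

definition iid :: "(nat \<Rightarrow> 'a \<Rightarrow> real) \<Rightarrow> bool" where
  "iid X \<longleftrightarrow>
     indep_vars (\<lambda>_. borel) X UNIV \<and>
     (\<forall>i j. distr M borel (X i) = distr M borel (X j))"

text \<open>
  The library's \<open>indep_var\<close> forces both variables to have the same value type, so independence
  of the process \<open>(N t)\<^sub>t\<close> from the sequence \<open>X 1, X 2, \<dots>\<close> is stated for the generated
  sigma-algebras.
\<close>

definition process_indep_of :: "(real \<Rightarrow> 'a \<Rightarrow> nat) \<Rightarrow> (nat \<Rightarrow> 'a \<Rightarrow> real) \<Rightarrow> bool" where
  "process_indep_of N X \<longleftrightarrow>
     indep_set
       (sigma_sets (space M) (\<Union>t\<in>{0..}. {N t -` A \<inter> space M | A. A \<in> sets (count_space UNIV)}))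
       (sigma_sets (space M) (\<Union>j\<in>{1..}. {X j -` B \<inter> space M | B. B \<in> sets borel}))"

end

definition mult_process ::
  "(real \<Rightarrow> 'a \<Rightarrow> nat) \<Rightarrow> (nat \<Rightarrow> 'a \<Rightarrow> real) \<Rightarrow> real \<Rightarrow> 'a \<Rightarrow> real" where
  "mult_process N X t \<omega> = (\<Prod>j=1..N t \<omega>. X j \<omega>)"

end

(*
Conditioning on the number of jumps, the multiplicativity of x^s turns the moment of the product
into the probability generating function of the Poisson law of N(t), evaluated at E X^s.  The
conditioning is carried out as the expansion of the integrand over the disjoint events N(t) = n;
the same computation with absolute values gives the integrability.
*)

theory Submission
  imports Defs
begin

lemma measurable_cpow: "(\<lambda>x. cpow x s) \<in> borel_measurable borel"
  unfolding cpow_def by measurable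

lemma pred_cpow_defined: "{x. cpow_defined x s} \<in> sets borel"
  unfolding cpow_defined_def by measurable

text \<open>For two positive factors this is additivity of \<open>ln\<close>. If a factor is 0,
  definedness forces \<open>Re s > 0\<close>, where both sides are 0, or \<open>s = 0\<close>, where
  both are 1; in these two cases every base \<ge> 0 is admissible, so the product stays in the
  domain.\<close>

lemma cpow_mult:
  assumes "cpow_defined x s" "cpow_defined y s"
  shows "cpow_defined (x * y) s" "cpow (x * y) s = cpow x s * cpow y s"
  using assms
  by (auto simp: cpow_defined_def cpow_def ln_mult exp_add ring_distribs zero_less_mult_iff)

lemma cpow_prod:
  assumes "\<And>i. i \<in> I \<Longrightarrow> cpow_defined (x i) s"
  shows "cpow_defined (\<Prod>i\<in>I. x i) s \<and> cpow (\<Prod>i\<in>I. x i) s = (\<Prod>i\<in>I. cpow (x i) s)"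
proof -
  \<comment> \<open>Serves the empty product, and also an infinite \<open>I\<close>, over which the
    product is 1 by convention.\<close>
  have one: "cpow_defined 1 s" "cpow 1 s = 1"
    by (auto simp: cpow_defined_def cpow_def)
  show ?thesis
    using assms by (induction I rule: infinite_finite_induct) (auto simp: one cpow_mult)
qed

context prob_space
begin

lemma iid_imp_indep_vars:
  assumes "iid X" shows "indep_vars (\<lambda>_. borel) X UNIV"
  using assms by (simp add: iid_def)

lemma iid_imp_measurable:
  assumes "iid X" shows "X j \<in> borel_measurable M"
  using iid_imp_indep_vars[OF assms] by (auto simp: indep_vars_def)

lemma iid_imp_distr_eq:
  assumes "iid X" shows "distr M borel (X i) = distr M borel (X j)"
  using assms unfolding iid_def by blast

lemma iid_integral_eq:
  fixes f :: "real \<Rightarrow> 'b::{banach, second_countable_topology}"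
  assumes "iid X" and [measurable]: "f \<in> borel_measurable borel"
  shows "(\<integral>\<omega>. f (X i \<omega>) \<partial>M) = (\<integral>\<omega>. f (X j \<omega>) \<partial>M)"
proof -
  note [measurable] = iid_imp_measurable[OF \<open>iid X\<close>]
  show ?thesis
    using arg_cong[OF iid_imp_distr_eq[OF \<open>iid X\<close>, of i j], of "\<lambda>D. integral\<^sup>L D f"]
    by (simp add: integral_distr)
qed

lemma iid_integrable_iff:
  fixes f :: "real \<Rightarrow> 'b::{banach, second_countable_topology}"
  assumes "iid X" and [measurable]: "f \<in> borel_measurable borel"
  shows "integrable M (\<lambda>\<omega>. f (X i \<omega>)) \<longleftrightarrow> integrable M (\<lambda>\<omega>. f (X j \<omega>))"
proof -
  note [measurable] = iid_imp_measurable[OF \<open>iid X\<close>]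
  show ?thesis
    using arg_cong[OF iid_imp_distr_eq[OF \<open>iid X\<close>, of i j], of "\<lambda>D. integrable D f"]
    by (simp add: integrable_distr_eq)
qed

lemma iid_AE_iff:
  assumes "iid X" and P: "{x. P x} \<in> sets borel"
  shows "(AE \<omega> in M. P (X i \<omega>)) \<longleftrightarrow> (AE \<omega> in M. P (X j \<omega>))"
  using arg_cong[OF iid_imp_distr_eq[OF \<open>iid X\<close>, of i j], of "\<lambda>D. AE x in D. P x"]
  by (simp add: AE_distr_iff iid_imp_measurable[OF \<open>iid X\<close>] P)

lemma poisson_process_measurable:
  assumes "poisson_process lam N" "0 \<le> t"
  shows "N t \<in> measurable M (count_space UNIV)"
  using assms by (auto simp: poisson_process_def)

text \<open>The process is specified through its increments; the law of \<open>N t\<close> is that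
  of the increment over \<open>[0, t]\<close>, because \<open>N 0 = 0\<close> almost surely and
  subtracting 0 on \<open>nat\<close> is exact.\<close>

lemma poisson_process_distr:
  assumes N: "poisson_process lam N" and t: "0 < t"
  shows "distr M (count_space UNIV) (N t) = measure_pmf (poisson_pmf (lam * t))"
proof -
  note [measurable] = poisson_process_measurable[OF N]
  have "AE \<omega> in M. N 0 \<omega> = 0"
    using N by (simp add: poisson_process_def)
  then have "AE \<omega> in M. N t \<omega> = N t \<omega> - N 0 \<omega>"
    by eventually_elim simp
  then have "distr M (count_space UNIV) (N t) = distr M (count_space UNIV) (\<lambda>\<omega>. N t \<omega> - N 0 \<omega>)"
    using t by (intro distr_cong_AE) auto
  also have "\<dots> = measure_pmf (poisson_pmf (lam * (t - 0)))"
    using N t unfolding poisson_process_def by blast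
  finally show ?thesis by simp
qed

text \<open>The indicator is measurable for the sigma-algebra of the process and the product for
  that of \<open>X 1, X 2, ...\<close>, so independence passes down to the sub-sigma-algebras they
  generate. The product must start at index 1, since \<open>X 0\<close> is not among the generators.
  \<open>of_real\<close> gives both variables the same value type.\<close>

lemma indep_indicator_prod:
  fixes f :: "real \<Rightarrow> 'b::{real_normed_field, banach, second_countable_topology}"
  assumes X: "\<And>j. X j \<in> borel_measurable M"
    and N: "N t \<in> measurable M (count_space UNIV)" and t: "0 \<le> t"
    and indep: "process_indep_of N X"
    and f[measurable]: "f \<in> borel_measurable borel"
  shows "indep_var borel (\<lambda>\<omega>. of_real (indicator {n} (N t \<omega>))) borel (\<lambda>\<omega>. \<Prod>j=1..n. f (X j \<omega>))"
proof -
  let ?GN = "\<Union>t\<in>{0..}. {N t -` A \<inter> space M | A. A \<in> sets (count_space UNIV)}"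
  let ?GX = "\<Union>j\<in>{1..}. {X j -` B \<inter> space M | B. B \<in> sets borel}"
  let ?SN = "sigma (space M) ?GN" and ?SX = "sigma (space M) ?GX"
  have GN: "?GN \<subseteq> Pow (space M)" and GX: "?GX \<subseteq> Pow (space M)"
    by auto
  have NS: "N t \<in> measurable ?SN (count_space UNIV)"
    using t by (intro measurableI) (auto simp: GN space_measure_of_conv)
  have XS: "X j \<in> borel_measurable ?SX" if "j \<in> {1..}" for j
    using that by (intro measurableI) (auto simp: GX space_measure_of_conv)
  have mI: "(\<lambda>\<omega>. of_real (indicator {n} (N t \<omega>)) :: 'b) \<in> borel_measurable ?SN"
    by (rule measurable_compose[OF NS]) simp
  have mZ: "(\<lambda>\<omega>. \<Prod>j=1..n. f (X j \<omega>)) \<in> borel_measurable ?SX"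
    by (intro borel_measurable_prod measurable_compose[OF XS f]) auto
  \<comment> \<open>A variable measurable for the sigma-algebra generated by \<open>G\<close>
    generates a smaller one.\<close>
  have sub: "sigma_sets (space M) {Y -` A \<inter> space M | A. A \<in> sets borel} \<subseteq> sigma_sets (space M) G"
    if "Y \<in> borel_measurable (sigma (space M) G)" "G \<subseteq> Pow (space M)" for Y :: "'a \<Rightarrow> 'b" and G
    using that measurable_sets[OF that(1)]
    by (intro sigma_sets_mono) (auto simp: space_measure_of_conv)
  have "indep_set (sigma_sets (space M) ?GN) (sigma_sets (space M) ?GX)"
    using indep by (simp add: process_indep_of_def)
  then have "indep_set
      (sigma_sets (space M) {(\<lambda>\<omega>. of_real (indicator {n} (N t \<omega>)) :: 'b) -` A \<inter> space M | A. A \<in> sets borel})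
      (sigma_sets (space M) {(\<lambda>\<omega>. \<Prod>j=1..n. f (X j \<omega>)) -` A \<inter> space M | A. A \<in> sets borel})"
    unfolding indep_set_def
    by (rule indep_sets_mono_sets) (use sub[OF mI GN] sub[OF mZ GX] in \<open>auto split: bool.split\<close>)
  then show ?thesis
    unfolding indep_var_eq
    by (auto intro!: borel_measurable_prod measurable_compose[OF X f] measurable_compose[OF N])
qed

text \<open>Two factorisations: the indicator splits off by independence of process and sequence,
  then the product splits into \<open>n\<close> equal expectations by the i.i.d. property. The value
  type is left general because both the complex integrand and its real norm are needed.\<close>

lemma integral_indicator_prod:
  fixes f :: "real \<Rightarrow> 'b::{real_normed_field, banach, second_countable_topology}"
  assumes X: "iid X"
    and N: "N t \<in> measurable M (count_space UNIV)" and t: "0 \<le> t"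
    and indep: "process_indep_of N X"
    and f: "f \<in> borel_measurable borel" and int: "integrable M (\<lambda>\<omega>. f (X 0 \<omega>))"
  shows "integrable M (\<lambda>\<omega>. of_real (indicator {n} (N t \<omega>)) * (\<Prod>j=1..n. f (X j \<omega>)))"
    and "(\<integral>\<omega>. of_real (indicator {n} (N t \<omega>)) * (\<Prod>j=1..n. f (X j \<omega>)) \<partial>M) =
      of_real (measure (distr M (count_space UNIV) (N t)) {n}) * (\<integral>\<omega>. f (X 0 \<omega>) \<partial>M) ^ n"
proof -
  note mX = iid_imp_measurable[OF X]
  have ind: "indep_vars (\<lambda>_. borel) (\<lambda>j \<omega>. f (X j \<omega>)) {1..n}"
    by (rule indep_vars_compose2[OF indep_vars_subset[OF iid_imp_indep_vars[OF X]]]) (auto simp: f)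
  have ints: "integrable M (\<lambda>\<omega>. f (X j \<omega>))" for j
    using int iid_integrable_iff[OF X f, of j 0] by simp
  have Z: "integrable M (\<lambda>\<omega>. \<Prod>j=1..n. f (X j \<omega>))"
    by (rule indep_vars_integrable[OF _ ind]) (auto simp: ints)
  have EZ: "(\<integral>\<omega>. (\<Prod>j=1..n. f (X j \<omega>)) \<partial>M) = (\<integral>\<omega>. f (X 0 \<omega>) \<partial>M) ^ n"
  proof -
    have "(\<integral>\<omega>. (\<Prod>j=1..n. f (X j \<omega>)) \<partial>M) = (\<Prod>j=1..n. \<integral>\<omega>. f (X j \<omega>) \<partial>M)"
      by (rule indep_vars_lebesgue_integral[OF _ ind]) (auto simp: ints)
    also have "\<dots> = (\<Prod>j=1..n. \<integral>\<omega>. f (X 0 \<omega>) \<partial>M)"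
      by (intro prod.cong refl iid_integral_eq[OF X f])
    finally show ?thesis by simp
  qed
  have I: "integrable M (\<lambda>\<omega>. indicator {n} (N t \<omega>) :: real)"
    by (rule integrable_const_bound[of _ 1])
      (auto intro!: measurable_compose[OF N] simp: indicator_def)
  then have I': "integrable M (\<lambda>\<omega>. of_real (indicator {n} (N t \<omega>)) :: 'b)"
    by (rule integrable_of_real)
  have "(\<integral>\<omega>. indicator {n} (N t \<omega>) \<partial>M) = (\<integral>k. indicator {n} k \<partial>distr M (count_space UNIV) (N t) :: real)"
    by (rule integral_distr[OF N, symmetric]) simp
  also have "\<dots> = measure (distr M (count_space UNIV) (N t)) {n}"
    by simp
  finally have EI: "(\<integral>\<omega>. of_real (indicator {n} (N t \<omega>)) \<partial>M) =
      (of_real (measure (distr M (count_space UNIV) (N t)) {n}) :: 'b)"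
    using I by simp
  note iv = indep_indicator_prod[OF mX N t indep f, of n]
  show "integrable M (\<lambda>\<omega>. of_real (indicator {n} (N t \<omega>)) * (\<Prod>j=1..n. f (X j \<omega>)))"
    by (rule indep_var_integrable[OF iv I' Z])
  show "(\<integral>\<omega>. of_real (indicator {n} (N t \<omega>)) * (\<Prod>j=1..n. f (X j \<omega>)) \<partial>M) =
      of_real (measure (distr M (count_space UNIV) (N t)) {n}) * (\<integral>\<omega>. f (X 0 \<omega>) \<partial>M) ^ n"
    by (simp only: indep_var_lebesgue_integral[OF iv I' Z] EZ EI)
qed

text \<open>This is the exponential series at \<open>a * z\<close>, multiplied by the Poisson
  normalisation \<open>exp (- a)\<close>.\<close>

lemma poisson_pgf_sums:
  fixes z :: "'b::{real_normed_field, banach}"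
  assumes "0 < a"
  shows "(\<lambda>n. of_real (pmf (poisson_pmf a) n) * z ^ n) sums exp (of_real a * (z - 1))"
proof -
  have "(\<lambda>n. (of_real a * z) ^ n /\<^sub>R fact n) sums exp (of_real a * z)"
    by (rule exp_converges)
  from sums_mult2[OF this, of "of_real (exp (- a))"] show ?thesis
    using assms
    by (simp add: scaleR_conv_of_real field_simps power_mult_distrib exp_minus exp_diff
        flip: exp_of_real)
qed

text \<open>Here \<open>f\<close> acts on each factor separately; multiplicativity of powers enters
  only afterwards, to identify this product almost surely with the power of the product.\<close>

lemma integral_poisson_product:
  fixes f :: "real \<Rightarrow> complex"
  assumes X: "iid X" and N: "poisson_process lam N" and lam: "0 < lam" and t: "0 < t"
    and indep: "process_indep_of N X"
    and f[measurable]: "f \<in> borel_measurable borel" and int: "integrable M (\<lambda>\<omega>. f (X 0 \<omega>))"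
  shows "integrable M (\<lambda>\<omega>. \<Prod>j=1..N t \<omega>. f (X j \<omega>))"
    and "(\<integral>\<omega>. (\<Prod>j=1..N t \<omega>. f (X j \<omega>)) \<partial>M) =
      exp (of_real (lam * t) * ((\<integral>\<omega>. f (X 0 \<omega>) \<partial>M) - 1))"
proof -
  \<comment> \<open>The integrand on the event \<open>N t = n\<close>, with the number of factors
    frozen at \<open>n\<close>.\<close>
  define g where "g n \<omega> = of_real (indicator {n} (N t \<omega>)) * (\<Prod>j=1..n. f (X j \<omega>))" for n \<omega>
  have a: "0 < lam * t" and t0: "0 \<le> t" using lam t by auto
  note mN = poisson_process_measurable[OF N t0]
  have p: "measure (distr M (count_space UNIV) (N t)) {n} = pmf (poisson_pmf (lam * t)) n" for n
    by (simp add: poisson_process_distr[OF N t] measure_pmf_single del: pmf_poisson)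
  have nf: "(\<lambda>x. norm (f x)) \<in> borel_measurable borel" by measurable
  note g_int = integral_indicator_prod[OF X mN t0 indep f int, folded g_def, unfolded p]
  note ng_int = integral_indicator_prod(2)[OF X mN t0 indep nf integrable_norm[OF int], unfolded p]
  have ng: "norm (g n \<omega>) = of_real (indicator {n} (N t \<omega>)) * (\<Prod>j=1..n. norm (f (X j \<omega>)))" for n \<omega>
    by (simp add: g_def norm_mult prod_norm)
  \<comment> \<open>At each \<omega> only the term \<open>n = N t \<omega>\<close> can be
    nonzero.\<close>
  have g_fin: "(\<lambda>n. g n \<omega>) sums (\<Prod>j=1..N t \<omega>. f (X j \<omega>))" for \<omega>
    using sums_finite[of "{N t \<omega>}" "\<lambda>n. g n \<omega>"] by (auto simp: g_def)
  have AE_summable: "AE \<omega> in M. summable (\<lambda>n. norm (g n \<omega>))"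
  proof (rule AE_I2)
    show "summable (\<lambda>n. norm (g n \<omega>))" for \<omega>
      by (rule summable_finite[of "{N t \<omega>}"]) (auto simp: g_def)
  qed
  \<comment> \<open>The norms sum to the Poisson generating function at the mean of
    \<open>norm (f (X 0 \<omega>))\<close>, which is finite; this licenses exchanging sum and
    integral.\<close>
  have summable: "summable (\<lambda>n. \<integral>\<omega>. norm (g n \<omega>) \<partial>M)"
    unfolding ng ng_int by (rule sums_summable[OF poisson_pgf_sums[OF a]])
  have eq: "(\<lambda>\<omega>. \<Sum>n. g n \<omega>) = (\<lambda>\<omega>. \<Prod>j=1..N t \<omega>. f (X j \<omega>))"
    using g_fin by (simp add: sums_iff)
  show "integrable M (\<lambda>\<omega>. \<Prod>j=1..N t \<omega>. f (X j \<omega>))"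
    using integrable_suminf[OF g_int(1) AE_summable summable] by (simp only: eq)
  have "(\<lambda>n. \<integral>\<omega>. g n \<omega> \<partial>M) sums (\<integral>\<omega>. (\<Prod>j=1..N t \<omega>. f (X j \<omega>)) \<partial>M)"
    using sums_integral[OF g_int(1) AE_summable summable] by (simp only: eq)
  moreover have "(\<lambda>n. \<integral>\<omega>. g n \<omega> \<partial>M) sums
      exp (of_real (lam * t) * ((\<integral>\<omega>. f (X 0 \<omega>) \<partial>M) - 1))"
    unfolding g_int(2) by (rule poisson_pgf_sums[OF a])
  ultimately show "(\<integral>\<omega>. (\<Prod>j=1..N t \<omega>. f (X j \<omega>)) \<partial>M) =
      exp (of_real (lam * t) * ((\<integral>\<omega>. f (X 0 \<omega>) \<partial>M) - 1))"
    by (rule sums_unique2)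
qed

end

(* X 0 is the generic copy written X in the mathematics; the factors of the product are
   X 1, X 2, ... *)
theorem mainTheorem11:
  fixes M :: "'a measure"
    and X :: "nat \<Rightarrow> 'a \<Rightarrow> real"
    and N :: "real \<Rightarrow> 'a \<Rightarrow> nat"
    and lam t :: real
    and \<eta> :: complex
  assumes "prob_space M"
    and "prob_space.iid M X"
    and "\<And>j. AE \<omega> in M. X j \<omega> \<ge> 0"
    and "lam > 0"
    and "prob_space.poisson_process M lam N"
    and "prob_space.process_indep_of M N X"
    and "t > 0"
    and "AE \<omega> in M. cpow_defined (X 0 \<omega>) (\<eta> - 1)"
    and "integrable M (\<lambda>\<omega>. cpow (X 0 \<omega>) (\<eta> - 1))"
  shows "(AE \<omega> in M. cpow_defined (mult_process N X t \<omega>) (\<eta> - 1)) \<and>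
         integrable M (\<lambda>\<omega>. cpow (mult_process N X t \<omega>) (\<eta> - 1)) \<and>
         (\<integral>\<omega>. cpow (mult_process N X t \<omega>) (\<eta> - 1) \<partial>M) =
           exp (of_real (lam * t) * ((\<integral>\<omega>. cpow (X 0 \<omega>) (\<eta> - 1) \<partial>M) - 1))"
proof -
  interpret prob_space M by fact
  note [measurable] = iid_imp_measurable[OF assms(2)] measurable_cpow
  \<comment> \<open>Equality in law moves definedness from \<open>X 0\<close> to each
    \<open>X j\<close>; a countable union of null sets then gives one exceptional set that works for
    a random number of factors.\<close>
  have "AE \<omega> in M. \<forall>j. cpow_defined (X j \<omega>) (\<eta> - 1)"
    unfolding AE_all_countable using assms(8) iid_AE_iff[OF assms(2) pred_cpow_defined] by blast
  then have AE: "AE \<omega> in M. cpow_defined (mult_process N X t \<omega>) (\<eta> - 1) \<and>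
      cpow (mult_process N X t \<omega>) (\<eta> - 1) = (\<Prod>j=1..N t \<omega>. cpow (X j \<omega>) (\<eta> - 1))"
    unfolding mult_process_def by eventually_elim (rule cpow_prod, blast)
  \<comment> \<open>The number of factors is random but takes countably many values, and for each
    fixed value the product is measurable.\<close>
  have [measurable]: "(\<lambda>\<omega>. mult_process N X t \<omega>) \<in> borel_measurable M"
  proof -
    have "N t \<in> measurable M (count_space UNIV)"
      using assms(7) by (intro poisson_process_measurable[OF assms(5)]) simp
    then show ?thesis
      unfolding mult_process_def
      by (rule measurable_compose_countable[where f = "\<lambda>n \<omega>. \<Prod>j=1..n. X j \<omega>", rotated])
        (intro borel_measurable_prod iid_imp_measurable[OF assms(2)])
  qed
  \<comment> \<open>The power of the product and the product of the powers agree only almost surely,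
    so transferring integrability and the integral calls for measurability of each.\<close>
  have m: "(\<lambda>\<omega>. cpow (mult_process N X t \<omega>) (\<eta> - 1)) \<in> borel_measurable M"
    by (rule measurable_compose[OF _ measurable_cpow]) measurable
  note main = integral_poisson_product[OF assms(2,5,4,7,6) measurable_cpow assms(9)]
  have AE_eq: "AE \<omega> in M. cpow (mult_process N X t \<omega>) (\<eta> - 1) = (\<Prod>j=1..N t \<omega>. cpow (X j \<omega>) (\<eta> - 1))"
    using AE by eventually_elim simp
  show ?thesis
    using AE main integrable_cong_AE[OF m borel_measurable_integrable[OF main(1)] AE_eq]
      integral_cong_AE[OF m borel_measurable_integrable[OF main(1)] AE_eq]
    by (auto elim: eventually_mono)
qed

end
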